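(* For every $n\ge4$, $$|\mathcal{RS}_n(123,132)|=2.$$
   Context: $\mathfrak{S}_n$ is the set of permutations of $\{1,\dots,n\}$, written in one-line notation $\pi=\pi_1\pi_2\dots\pi_n$. A permutation $\pi\in\mathfrak{S}_n$ is simsun if for every $3\le k\le n$, the subword of $\pi_1\pi_2\dots\pi_n$ consisting of the entries in $\{1,\dots,k\}$ (kept in their order) has no double descent, i.e. no three entries that are consecutive in that subword and in decreasing order. A permutation $\pi\in\mathfrak{S}_n$ avoids the pattern $\sigma\in\mathfrak{S}_k$ if there are no indices $i_1<i_2<\dots<i_k$ such that $\pi_{i_1}\pi_{i_2}\dots\pi_{i_k}$ is in the same relative order as $\sigma$. $\mathcal{RS}_n(\sigma,\tau)$ is the set of simsun permutations in $\mathfrak{S}_n$ avoiding both $\sigma$ and $\tau$. *)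

theory Defs
  imports Main "HOL-Combinatorics.Multiset_Permutations"
begin

text \<open>
  A permutation in \<open>S\<^sub>n\<close> is its one-line notation, i.e. an element of
  \<^term>\<open>permutations_of_set {1..n::nat}\<close>. List positions are counted from 0,
  whereas the entries are \<open>1, \<dots>, n\<close>.
\<close>

definition has_double_descent :: "nat list \<Rightarrow> bool" where
  "has_double_descent w \<longleftrightarrow>
     (\<exists>i. i + 2 < length w \<and> w ! i > w ! (i + 1) \<and> w ! (i + 1) > w ! (i + 2))"

definition simsun :: "nat list \<Rightarrow> bool" where
  "simsun p \<longleftrightarrow>
     (\<forall>k\<in>{3..length p}. \<not> has_double_descent (filter (\<lambda>x. x \<in> {1..k}) p))"

definition order_isomorphic :: "nat list \<Rightarrow> nat list \<Rightarrow> bool" where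
  "order_isomorphic u v \<longleftrightarrow> length u = length v \<and>
     (\<forall>a<length u. \<forall>b<length u. u ! a < u ! b \<longleftrightarrow> v ! a < v ! b)"

definition contains_pattern :: "nat list \<Rightarrow> nat list \<Rightarrow> bool" where
  "contains_pattern p s \<longleftrightarrow>
     (\<exists>i :: nat \<Rightarrow> nat. strict_mono_on {..<length s} i \<and> i ` {..<length s} \<subseteq> {..<length p} \<and>
        order_isomorphic (map (\<lambda>j. p ! i j) [0..<length s]) s)"

definition avoids :: "nat list \<Rightarrow> nat list \<Rightarrow> bool" where
  "avoids p s \<longleftrightarrow> \<not> contains_pattern p s"

definition RS :: "nat \<Rightarrow> nat list \<Rightarrow> nat list \<Rightarrow> nat list set" where
  "RS n s t = {p \<in> permutations_of_set {1..n}. simsun p \<and> avoids p s \<and> avoids p t}"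

end

theory Submission
  imports Defs
begin

text \<open>
  Avoiding both 123 and 132 means that no entry is followed by two larger ones. Deleting the
  largest entry \<open>n + 1\<close> preserves this property and the simsun property, so every permutation
  under consideration arises from one of size \<open>n\<close> by inserting \<open>n + 1\<close>. The new entry can be
  put only behind entries that had no larger entry to their right before, and not so that a
  double descent arises. These two restrictions leave no choice. Let
  \<open>A\<^sub>n = n-1, n, n-3, n-2, \<dots>\<close> be the \<open>ascent_blocks\<close> word and \<open>B\<^sub>n = n, A\<^sub>n\<^sub>-\<^sub>1\<close>. For \<open>n \<ge> 3\<close>,

    \<^item> \<open>A\<^sub>n\<close> starts with \<open>n-1, n\<close>, so \<open>n + 1\<close> has to go to the front, which gives \<open>B\<^sub>n\<^sub>+\<^sub>1\<close>;

    \<^item> \<open>B\<^sub>n\<close> starts with \<open>n, n-2, n-1\<close>; the front is excluded by the double descent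
      \<open>n+1, n, n-2\<close>, any place behind \<open>n-2\<close> by the later entries \<open>n-1, n+1\<close>, and the one
      remaining place gives \<open>A\<^sub>n\<^sub>+\<^sub>1\<close>.

  For \<open>n = 3\<close> there is a third permutation, 213, and it admits no insertion at all. Hence
  exactly \<open>A\<^sub>n\<close> and \<open>B\<^sub>n\<close> remain for \<open>n \<ge> 4\<close>. Conversely, deleting the largest entry exchanges
  the two families, and neither of them has a double descent, so both are simsun.
\<close>

section \<open>Double descents and the simsun property\<close>

lemma has_double_descent_Nil [simp]: "\<not> has_double_descent []"
  by (simp add: has_double_descent_def)

lemma has_double_descent_Cons:
  "has_double_descent (x # w) \<longleftrightarrow>
     (\<exists>y z v. w = y # z # v \<and> x > y \<and> y > z) \<or> has_double_descent w"
  (is "?L \<longleftrightarrow> ?R")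
proof
  assume ?L
  then obtain i where i: "i + 2 < length (x # w)" "(x # w) ! i > (x # w) ! (i + 1)"
    "(x # w) ! (i + 1) > (x # w) ! (i + 2)"
    unfolding has_double_descent_def by blast
  show ?R
  proof (cases i)
    case 0
    then have "2 \<le> length w" using i(1) by simp
    then obtain y z v where "w = y # z # v"
      by (metis Suc_le_length_iff numeral_2_eq_2)
    then show ?thesis using i 0 by simp
  next
    case (Suc j)
    then have "has_double_descent w"
      unfolding has_double_descent_def using i by (intro exI[of _ j]) simp
    then show ?thesis ..
  qed
next
  assume ?R
  then show ?L
  proof
    assume "\<exists>y z v. w = y # z # v \<and> x > y \<and> y > z"
    then show ?L unfolding has_double_descent_def by (intro exI[of _ 0]) auto
  next
    assume "has_double_descent w"
    then obtain i where "i + 2 < length w" "w ! i > w ! (i + 1)" "w ! (i + 1) > w ! (i + 2)"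
      unfolding has_double_descent_def by blast
    then show ?L unfolding has_double_descent_def by (intro exI[of _ "Suc i"]) simp
  qed
qed

lemma length_permutation:
  "p \<in> permutations_of_set {1..n::nat} \<Longrightarrow> length p = n"
  by (auto simp: permutations_of_set_def dest: distinct_card)

lemma filter_le_permutation:
  assumes "p \<in> permutations_of_set {1..Suc n}"
  shows "filter (\<lambda>x. x \<le> n) p \<in> permutations_of_set {1..n}"
  using assms by (auto simp: permutations_of_set_def)

text \<open>
  The subwords on \<open>{1..k}\<close> with \<open>k \<le> n\<close> are also subwords of the word without \<open>n + 1\<close>; only
  the word itself has to be examined in addition.
\<close>

lemma simsun_Suc_iff:
  assumes p: "p \<in> permutations_of_set {1..Suc n}" and n: "n \<ge> 2"
  shows "simsun p \<longleftrightarrow> \<not> has_double_descent p \<and> simsun (filter (\<lambda>x. x \<le> n) p)"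
proof -
  have "filter (\<lambda>x. x \<in> {1..Suc n}) p = p"
    using p by (auto simp: permutations_of_set_def filter_id_conv)
  moreover have "filter (\<lambda>x. x \<in> {1..k}) (filter (\<lambda>x. x \<le> n) p) = filter (\<lambda>x. x \<in> {1..k}) p"
    if "k \<le> n" for k
    unfolding filter_filter using that by (intro filter_cong) auto
  moreover have "{3..Suc n} = insert (Suc n) {3..n}" using n by auto
  ultimately show ?thesis
    using length_permutation[OF p] length_permutation[OF filter_le_permutation[OF p]]
    unfolding simsun_def by auto
qed

section \<open>Avoiding 123 and 132\<close>

lemma contains_pattern_3:
  "contains_pattern p [a, b, c] \<longleftrightarrow>
     (\<exists>i j k. i < j \<and> j < k \<and> k < length p \<and> order_isomorphic [p ! i, p ! j, p ! k] [a, b, c])"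
  (is "?L \<longleftrightarrow> ?R")
proof
  have less3: "{..<length [a, b, c]} = {0, 1, 2}" by auto
  {
    assume ?L
    then obtain f :: "nat \<Rightarrow> nat" where f: "strict_mono_on {0, 1, 2} f"
      "f ` {0, 1, 2} \<subseteq> {..<length p}"
      "order_isomorphic (map (\<lambda>j. p ! f j) [0..<length [a, b, c]]) [a, b, c]"
      unfolding contains_pattern_def less3 by blast
    have "f 0 < f 1" "f 1 < f 2" using f(1) by (auto intro: strict_mono_onD)
    moreover have "f 2 < length p" using f(2) by simp
    ultimately show ?R using f(3)
      by (intro exI[of _ "f 0"] exI[of _ "f 1"] exI[of _ "f 2"])
         (simp add: upt_rec numeral_2_eq_2)
  next
    assume ?R
    then obtain i j k where ijk: "i < j" "j < k" "k < length p"
      "order_isomorphic [p ! i, p ! j, p ! k] [a, b, c]" by blast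
    define f where "f = (\<lambda>m::nat. if m = 0 then i else if m = 1 then j else k)"
    have "strict_mono_on {0, 1, 2} f" "f ` {0, 1, 2} \<subseteq> {..<length p}"
      using ijk by (auto simp: f_def strict_mono_on_def)
    moreover have "map (\<lambda>m. p ! f m) [0..<length [a, b, c]] = [p ! i, p ! j, p ! k]"
      by (simp add: f_def upt_rec)
    ultimately show ?L
      unfolding contains_pattern_def less3 using ijk(4) by (intro exI[of _ f]) simp
  }
qed

lemma order_isomorphic_123:
  "order_isomorphic [x, y, z] [1, 2, 3] \<longleftrightarrow> x < y \<and> y < z"
  by (auto simp: order_isomorphic_def All_less_Suc numeral_3_eq_3)

lemma order_isomorphic_132:
  "order_isomorphic [x, y, z] [1, 3, 2] \<longleftrightarrow> x < z \<and> z < y"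
  by (auto simp: order_isomorphic_def All_less_Suc numeral_3_eq_3)

fun larger_to_right_unique :: "nat list \<Rightarrow> bool" where
  "larger_to_right_unique [] \<longleftrightarrow> True"
| "larger_to_right_unique (x # w) \<longleftrightarrow>
     (\<forall>y\<in>set w. \<forall>z\<in>set w. x < y \<longrightarrow> x < z \<longrightarrow> y = z) \<and> larger_to_right_unique w"

lemma larger_to_right_unique_iff_nth:
  assumes "distinct p"
  shows "larger_to_right_unique p \<longleftrightarrow>
     \<not> (\<exists>i j k. i < j \<and> j < k \<and> k < length p \<and> p ! i < p ! j \<and> p ! i < p ! k)"
  using assms
proof (induction p)
  case Nil
  then show ?case by simp
next
  case (Cons x w)
  have head: "(\<forall>y\<in>set w. \<forall>z\<in>set w. x < y \<longrightarrow> x < z \<longrightarrow> y = z) \<longleftrightarrow>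
      \<not> (\<exists>j k. j < k \<and> k < length w \<and> x < w ! j \<and> x < w ! k)" (is "?A \<longleftrightarrow> \<not> ?B")
  proof
    assume A: ?A
    show "\<not> ?B"
    proof
      assume ?B
      then obtain j k where jk: "j < k" "k < length w" "x < w ! j" "x < w ! k" by blast
      then have "w ! j = w ! k" using A by simp
      then show False using jk Cons.prems by (simp add: nth_eq_iff_index_eq)
    qed
  next
    assume B: "\<not> ?B"
    show ?A
    proof (intro ballI impI)
      fix y z assume yz: "y \<in> set w" "z \<in> set w" "x < y" "x < z"
      then obtain j k where "j < length w" "w ! j = y" "k < length w" "w ! k = z"
        by (meson in_set_conv_nth)
      then show "y = z" using B yz by (metis linorder_neqE_nat)
    qed
  qed
  have split: "(\<exists>i j k. i < j \<and> j < k \<and> k < length (x # w) \<and>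
        (x # w) ! i < (x # w) ! j \<and> (x # w) ! i < (x # w) ! k) \<longleftrightarrow>
      (\<exists>j k. j < k \<and> k < length w \<and> x < w ! j \<and> x < w ! k) \<or>
      (\<exists>i j k. i < j \<and> j < k \<and> k < length w \<and> w ! i < w ! j \<and> w ! i < w ! k)"
    (is "?L \<longleftrightarrow> ?R")
  proof
    assume ?L
    then obtain i j k where ijk: "i < j" "j < k" "k < length (x # w)"
      "(x # w) ! i < (x # w) ! j" "(x # w) ! i < (x # w) ! k" by blast
    then obtain j' k' where "j = Suc j'" "k = Suc k'"
      by (metis less_imp_Suc_add)
    then show ?R using ijk by (cases i) auto
  next
    assume ?R
    then show ?L
    proof (elim disjE exE)
      fix j k assume "j < k \<and> k < length w \<and> x < w ! j \<and> x < w ! k"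
      then show ?L by (intro exI[of _ 0] exI[of _ "Suc j"] exI[of _ "Suc k"]) simp
    next
      fix i j k assume "i < j \<and> j < k \<and> k < length w \<and> w ! i < w ! j \<and> w ! i < w ! k"
      then show ?L by (intro exI[of _ "Suc i"] exI[of _ "Suc j"] exI[of _ "Suc k"]) simp
    qed
  qed
  show ?case
    unfolding split using head Cons by simp
qed

text \<open>
  An entry followed by two larger ones is a 123 or a 132, according to the order of these two.
\<close>

lemma avoids_123_132_iff:
  assumes "distinct p"
  shows "avoids p [1, 2, 3] \<and> avoids p [1, 3, 2] \<longleftrightarrow> larger_to_right_unique p"
proof -
  have "p ! j < p ! k \<or> p ! k < p ! j" if "j < k" "k < length p" for j k
    using that assms by (metis less_trans linorder_neqE_nat nat_neq_iff nth_eq_iff_index_eq)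
  then show ?thesis
    unfolding avoids_def contains_pattern_3 order_isomorphic_123 order_isomorphic_132
      larger_to_right_unique_iff_nth[OF assms]
    by (meson less_trans)
qed

lemma RS_123_132_iff:
  "p \<in> RS n [1, 2, 3] [1, 3, 2] \<longleftrightarrow>
     p \<in> permutations_of_set {1..n} \<and> simsun p \<and> larger_to_right_unique p"
  using avoids_123_132_iff[of p] by (auto simp: RS_def permutations_of_set_def)

lemma larger_to_right_unique_filter:
  "larger_to_right_unique p \<Longrightarrow> larger_to_right_unique (filter P p)"
  by (induction p) auto

section \<open>Inserting the largest entry\<close>

fun ascent_blocks :: "nat \<Rightarrow> nat list" where
  "ascent_blocks 0 = []"
| "ascent_blocks (Suc 0) = [1]"
| "ascent_blocks (Suc (Suc n)) = Suc n # Suc (Suc n) # ascent_blocks n"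

lemma RS_insert_cases:
  assumes "p \<in> RS (Suc n) [1, 2, 3] [1, 3, 2]" and "n \<ge> 2"
  obtains u v where "p = u @ Suc n # v" "u @ v \<in> RS n [1, 2, 3] [1, 3, 2]"
    "larger_to_right_unique p" "\<not> has_double_descent p"
proof -
  have p: "p \<in> permutations_of_set {1..Suc n}" "simsun p" "larger_to_right_unique p"
    using assms(1) unfolding RS_123_132_iff by auto
  then have "Suc n \<in> set p" by (simp add: permutations_of_set_def)
  then obtain u v where uv: "p = u @ Suc n # v" by (meson split_list)
  have "\<forall>x\<in>set (u @ v). x \<le> n"
  proof
    fix x assume x: "x \<in> set (u @ v)"
    then have "x \<in> {1..Suc n}" "x \<noteq> Suc n"
      using p(1) unfolding uv permutations_of_set_def by auto
    then show "x \<le> n" by simp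
  qed
  then have filter_p: "filter (\<lambda>x. x \<le> n) p = u @ v"
    unfolding uv by (simp add: filter_id_conv)
  have "\<not> has_double_descent p" "simsun (u @ v)"
    using p(2) simsun_Suc_iff[OF p(1) assms(2)] filter_p by auto
  moreover have "u @ v \<in> RS n [1, 2, 3] [1, 3, 2]"
    using filter_le_permutation[OF p(1)] larger_to_right_unique_filter[OF p(3), of "\<lambda>x. x \<le> n"]
      \<open>simsun (u @ v)\<close> filter_p unfolding RS_123_132_iff by simp
  ultimately show ?thesis using that uv p(3) by blast
qed

text \<open>
  If an entry is already followed by a larger one, the new maximum can only go before it:
  behind it, it would be a second larger entry to the right.
\<close>

lemma insert_maximum_before:
  assumes "larger_to_right_unique (u @ m # v)" and "u @ v = a # b # w"
    and "a < b" and "b < m"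
  shows "u = []"
proof (rule ccontr)
  assume "u \<noteq> []"
  then obtain u' where u: "u = a # u'" "u' @ v = b # w"
    using assms(2) by (cases u) auto
  then have "b \<in> set (u' @ m # v)"
    using u(2) by (metis Un_iff list.set_intros(1) list.set_intros(2) set_append)
  then show False using assms(1,3,4) unfolding u(1) by fastforce
qed

lemma RS_3_cases:
  assumes "p \<in> RS 3 [1, 2, 3] [1, 3, 2]"
  shows "p \<in> {ascent_blocks 3, 3 # ascent_blocks 2, [2, 1, 3]}"
proof -
  have p: "set p = {1..3}" "distinct p" "simsun p" "larger_to_right_unique p"
    using assms unfolding RS_123_132_iff permutations_of_set_def by auto
  have "length p = 3" using assms by (simp add: RS_def length_permutation)
  then obtain a b c where abc: "p = [a, b, c]"
    by (auto simp: numeral_3_eq_3 length_Suc_conv)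
  have "\<not> has_double_descent (filter (\<lambda>x. x \<in> {1..3}) p)"
    using p(3) abc by (simp add: simsun_def)
  moreover have "filter (\<lambda>x. x \<in> {1..3}) p = p"
    using p(1) by (simp add: filter_id_conv)
  ultimately have "\<not> has_double_descent p" by simp
  moreover have "a \<in> {1..3}" "b \<in> {1..3}" "c \<in> {1..3}"
    using p(1) abc by auto
  then have "a \<in> {1, 2, 3}" "b \<in> {1, 2, 3}" "c \<in> {1, 2, 3}" by auto
  ultimately show ?thesis
    using p(2,4) unfolding abc
    by (auto simp: has_double_descent_Cons numeral_2_eq_2 numeral_3_eq_3)
qed

text \<open>
  The exceptional 213 occurs among the words to be extended but not among the results, so
  this step both removes it in the passage from 3 to 4 and can be iterated from 3 onwards.
\<close>

lemma RS_Suc_cases: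
  assumes p: "p \<in> RS (Suc n) [1, 2, 3] [1, 3, 2]" and n: "n \<ge> 3"
    and IH: "\<And>q. q \<in> RS n [1, 2, 3] [1, 3, 2] \<Longrightarrow>
      q \<in> {ascent_blocks n, n # ascent_blocks (n - 1), [2, 1, 3]}"
  shows "p \<in> {ascent_blocks (Suc n), Suc n # ascent_blocks n}"
proof -
  obtain m where m: "n = Suc (Suc (Suc m))"
    using n by (metis numeral_3_eq_3 Suc_le_D Suc_le_mono)
  obtain u v where uv: "p = u @ Suc n # v" "u @ v \<in> RS n [1, 2, 3] [1, 3, 2]"
    and p': "larger_to_right_unique p" "\<not> has_double_descent p"
    using RS_insert_cases[OF p] n by auto
  consider "u @ v = ascent_blocks n" | "u @ v = n # ascent_blocks (n - 1)" | "u @ v = [2, 1, 3]"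
    using IH[OF uv(2)] by blast
  then show ?thesis
  proof cases
    case 1
    then have "u = []"
      using p'(1) m unfolding uv(1) by (intro insert_maximum_before[of u "Suc n" v]) auto
    then show ?thesis using uv(1) 1 by simp
  next
    case 2
    then have uv_eq: "u @ v = n # Suc m # Suc (Suc m) # ascent_blocks m" using m by simp
    have "u \<noteq> []"
    proof
      assume "u = []"
      then show False using p'(2) uv_eq m unfolding uv(1)
        by (simp add: has_double_descent_Cons) (metis lessI)
    qed
    then obtain u' where u': "u = n # u'" "u' @ v = Suc m # Suc (Suc m) # ascent_blocks m"
      using uv_eq by (cases u) auto
    have "u' = []"
      using p'(1) u'(2) m unfolding uv(1) u'(1)
      by (intro insert_maximum_before[of u' "Suc n" v]) auto
    then show ?thesis using uv(1) u' m by simp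
  next
    case 3
    have "u \<noteq> []"
    proof
      assume "u = []"
      then have "\<not> (2 < Suc n)"
        using p'(2) 3 unfolding uv(1) by (auto simp: has_double_descent_Cons)
      then show False using n by simp
    qed
    \<comment> \<open>Behind the entry 2, the new maximum is the second larger entry, besides 3.\<close>
    then obtain u' where u': "u = 2 # u'" "u' @ v = [1, 3]" using 3 by (cases u) auto
    then have "3 \<in> set (u' @ Suc n # v)"
      by (metis Un_iff list.set_intros(1) list.set_intros(2) set_append)
    then have False using p'(1) n unfolding uv(1) u'(1) by fastforce
    then show ?thesis ..
  qed
qed

lemma RS_subset:
  assumes "n \<ge> 4"
  shows "RS n [1, 2, 3] [1, 3, 2] \<subseteq> {ascent_blocks n, n # ascent_blocks (n - 1)}"
proof -
  have three: "p \<in> {ascent_blocks n, n # ascent_blocks (n - 1), [2, 1, 3]}"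
    if "n \<ge> 3" "p \<in> RS n [1, 2, 3] [1, 3, 2]" for n p
    using that
  proof (induction n arbitrary: p rule: dec_induct)
    case base
    then show ?case using RS_3_cases by simp
  next
    case (step n)
    then show ?case using RS_Suc_cases[of p n] by auto
  qed
  obtain m where m: "n = Suc m" "m \<ge> 3" using assms by (cases n) auto
  show ?thesis
  proof
    fix p assume "p \<in> RS n [1, 2, 3] [1, 3, 2]"
    then show "p \<in> {ascent_blocks n, n # ascent_blocks (n - 1)}"
      using RS_Suc_cases[of p m] three[of m] m by simp
  qed
qed

section \<open>The two surviving families\<close>

lemma set_ascent_blocks: "set (ascent_blocks n) = {1..n}"
  by (induction n rule: ascent_blocks.induct) auto

lemma distinct_ascent_blocks: "distinct (ascent_blocks n)"
  by (induction n rule: ascent_blocks.induct) (auto simp: set_ascent_blocks)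

lemma ascent_blocks_permutation: "ascent_blocks n \<in> permutations_of_set {1..n}"
  by (simp add: permutations_of_set_def set_ascent_blocks distinct_ascent_blocks)

lemma Cons_ascent_blocks_permutation:
  "Suc n # ascent_blocks n \<in> permutations_of_set {1..Suc n}"
  by (auto simp: permutations_of_set_def set_ascent_blocks distinct_ascent_blocks)

lemma larger_to_right_unique_ascent_blocks: "larger_to_right_unique (ascent_blocks n)"
  by (induction n rule: ascent_blocks.induct) (auto simp: set_ascent_blocks)

lemma larger_to_right_unique_Cons_ascent_blocks:
  "larger_to_right_unique (Suc n # ascent_blocks n)"
  by (auto simp: set_ascent_blocks larger_to_right_unique_ascent_blocks)

text \<open>
  Every block is an ascent, except possibly a final single entry 1 that nothing follows, so a
  descent into a block is never followed by another descent.
  The arbitrary \<open>x\<close> stands for the last entry of the preceding block in the induction.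
\<close>

lemma no_double_descent_Cons_ascent_blocks: "\<not> has_double_descent (x # ascent_blocks n)"
  by (induction n arbitrary: x rule: ascent_blocks.induct)
     (auto simp: has_double_descent_Cons)

lemma no_double_descent_ascent_blocks: "\<not> has_double_descent (ascent_blocks n)"
  using no_double_descent_Cons_ascent_blocks has_double_descent_Cons by blast

lemma filter_ascent_blocks:
  assumes "n \<le> k" shows "filter (\<lambda>x. x \<le> k) (ascent_blocks n) = ascent_blocks n"
  using assms by (simp add: filter_id_conv set_ascent_blocks)

text \<open>
  The two families are treated together because deleting the largest entry exchanges them.
\<close>

lemma simsun_ascent_blocks:
  "simsun (ascent_blocks (Suc n)) \<and> simsun (Suc n # ascent_blocks n)"
proof (induction n)
  case 0
  then show ?case by (simp add: simsun_def)
next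
  case (Suc n)
  show ?case
  proof (cases "n = 0")
    case True
    then show ?thesis by (simp add: simsun_def)
  next
    case False
    have "filter (\<lambda>x. x \<le> Suc n) (ascent_blocks (Suc (Suc n))) = Suc n # ascent_blocks n"
      "filter (\<lambda>x. x \<le> Suc n) (Suc (Suc n) # ascent_blocks (Suc n)) = ascent_blocks (Suc n)"
      by (simp_all add: filter_ascent_blocks)
    then show ?thesis
      using Suc False simsun_Suc_iff[OF ascent_blocks_permutation, of "Suc n"]
        simsun_Suc_iff[OF Cons_ascent_blocks_permutation, of "Suc n"]
        no_double_descent_ascent_blocks[of "Suc (Suc n)"] no_double_descent_Cons_ascent_blocks
      by simp
  qed
qed

lemma RS_123_132_eq:
  assumes "n \<ge> 4"
  shows "RS n [1, 2, 3] [1, 3, 2] = {ascent_blocks n, n # ascent_blocks (n - 1)}"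
proof
  obtain m where m: "n = Suc m" using assms by (cases n) auto
  show "{ascent_blocks n, n # ascent_blocks (n - 1)} \<subseteq> RS n [1, 2, 3] [1, 3, 2]"
    unfolding m using simsun_ascent_blocks[of m]
      ascent_blocks_permutation[of "Suc m"] Cons_ascent_blocks_permutation[of m]
      larger_to_right_unique_ascent_blocks[of "Suc m"]
      larger_to_right_unique_Cons_ascent_blocks[of m]
    unfolding insert_subset RS_123_132_iff diff_Suc_1 by blast
qed (fact RS_subset[OF assms])

theorem lemma7p1:
  fixes n :: nat
  assumes "n \<ge> 4"
  shows "card (RS n [1, 2, 3] [1, 3, 2]) = 2"
proof -
  obtain m where "n = Suc (Suc m)" using that[of "n - 2"] assms by simp
  then have "ascent_blocks n \<noteq> n # ascent_blocks (n - 1)" by simp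
  then show ?thesis unfolding RS_123_132_eq[OF assms] by simp
qed

end
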